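(* Let $G$ be a topological group, $X$ a (not necessarily compact) $G$-space and $f\in\mathrm{RUC}(X)$. The following conditions are equivalent: (1) $X_f\subset\mathrm{UC}(G)$. (2) $(G,X_f)$ is SUC. (3) $f\in\mathrm{SUC}(X)$.
   Context: A $G$-space is a Tychonoff space with a continuous left action of $G$. $C(X)$ is the Banach algebra of bounded continuous real functions on $X$ (supremum norm). $\mathrm{RUC}(X)$ is the set of $f\in C(X)$ for which the orbit map $G\to C(X)$, $g\mapsto fg$, $(fg)(x)=f(gx)$, is norm continuous. $\mathrm{UC}(G)$ is the algebra of bounded continuous $f\colon G\to\mathbb{R}$ such that for every $\varepsilon>0$ there is a neighborhood $V$ of $e$ with $\sup_{g}|f(vg)-f(g)|<\varepsilon$ and $\sup_g|f(gv)-f(g)|<\varepsilon$ for all $v\in V$. For $f\in\mathrm{RUC}(X)$ let $I=[-\|f\|,\|f\|]$ and $\Omega=I^G$ with the product topology, on which $G$ acts by $(g\omega)(h)=\omega(hg)$. Define $f_\sharp\colon X\to\Omega$, $f_\sharp(x)(g)=f(gx)$, and $X_f:=\mathrm{cl}(f_\sharp(X))\subset\Omega$. Elements of $X_f$ are functions on $G$, $X_f$ is contained in $\mathrm{RUC}(G)$, and $X_f$ is a compact $G$-space (the action restricted to $X_f$ is continuous). A compact $G$-space $Y$, with its unique compatible uniformity $\mu_Y$, is SUC if for every $y_0\in Y$ and every $\varepsilon\in\mu_Y$ there is a neighborhood $U$ of $e$ such that $(guy_0,gy_0)\in\varepsilon$ for all $g\in G$, $u\in U$. $f\in C(X)$ belongs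 to $\mathrm{SUC}(X)$ if $f=F\circ\nu$ for some compact SUC $G$-space $Y$, some continuous $G$-equivariant map $\nu\colon X\to Y$ with dense image and some continuous $F\colon Y\to\mathbb{R}$. *)

theory Defs
  imports "HOL-Analysis.Analysis"
begin

text \<open>
  The acting group is a type of class \<^class>\<open>topological_group_add\<close>. This class does not assume
  commutativity; \<open>g + h\<close>, \<open>0\<close> and \<open>- g\<close> stand for the product \<open>gh\<close>, the neutral element and
  the inverse of an arbitrary topological group. Spaces are values of type \<open>'x topology\<close>.
\<close>

definition Tychonoff_space :: "'x topology \<Rightarrow> bool" where
  "Tychonoff_space X \<longleftrightarrow> completely_regular_space X \<and> Hausdorff_space X"

definition G_space :: "('g::topological_group_add \<Rightarrow> 'x \<Rightarrow> 'x) \<Rightarrow> 'x topology \<Rightarrow> bool" where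
  "G_space act X \<longleftrightarrow>
     Tychonoff_space X \<and>
     continuous_map (prod_topology euclidean X) X (\<lambda>(g, x). act g x) \<and>
     (\<forall>x\<in>topspace X. act 0 x = x) \<and>
     (\<forall>g h. \<forall>x\<in>topspace X. act (g + h) x = act g (act h x))"

definition bounded_cont :: "'x topology \<Rightarrow> ('x \<Rightarrow> real) set" where
  "bounded_cont X = {f. continuous_map X euclideanreal f \<and> bounded (f ` topspace X)}"

text \<open>The inserted \<open>0\<close> only matters when \<open>X\<close> is empty.\<close>

definition sup_norm :: "'x topology \<Rightarrow> ('x \<Rightarrow> real) \<Rightarrow> real" where
  "sup_norm X f = Sup (insert 0 ((\<lambda>x. \<bar>f x\<bar>) ` topspace X))"

definition RUC :: "('g::topological_group_add \<Rightarrow> 'x \<Rightarrow> 'x) \<Rightarrow> 'x topology \<Rightarrow> ('x \<Rightarrow> real) set" where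
  "RUC act X = {f \<in> bounded_cont X.
     \<forall>g0. ((\<lambda>g. sup_norm X (\<lambda>x. f (act g x) - f (act g0 x))) \<longlongrightarrow> 0) (nhds g0)}"

definition UC :: "('g::topological_group_add \<Rightarrow> real) set" where
  "UC = {f \<in> bounded_cont euclidean.
     \<forall>e>0. \<forall>\<^sub>F v in nhds 0.
       sup_norm euclidean (\<lambda>g. f (v + g) - f g) < e \<and>
       sup_norm euclidean (\<lambda>g. f (g + v) - f g) < e}"

definition shift :: "'g::topological_group_add \<Rightarrow> ('g \<Rightarrow> real) \<Rightarrow> 'g \<Rightarrow> real" where
  "shift g \<omega> = (\<lambda>h. \<omega> (h + g))"

definition sharp :: "('g \<Rightarrow> 'x \<Rightarrow> 'x) \<Rightarrow> ('x \<Rightarrow> real) \<Rightarrow> 'x \<Rightarrow> 'g \<Rightarrow> real" where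
  "sharp act f x = (\<lambda>g. f (act g x))"

definition Omega :: "'x topology \<Rightarrow> ('x \<Rightarrow> real) \<Rightarrow> ('g \<Rightarrow> real) topology" where
  "Omega X f = product_topology (\<lambda>_. top_of_set {- sup_norm X f .. sup_norm X f}) UNIV"

definition X_sub :: "('g \<Rightarrow> 'x \<Rightarrow> 'x) \<Rightarrow> 'x topology \<Rightarrow> ('x \<Rightarrow> real) \<Rightarrow> ('g \<Rightarrow> real) topology" where
  "X_sub act X f =
     subtopology (Omega X f) (Omega X f closure_of (sharp act f ` topspace X))"

text \<open>Uniformities on a set (families of entourages), and compatibility with a topology.\<close>

definition uniformity_on_set :: "'y set \<Rightarrow> ('y \<times> 'y) set set \<Rightarrow> bool" where
  "uniformity_on_set S U \<longleftrightarrow>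
     U \<noteq> {} \<and>
     (\<forall>E\<in>U. Id_on S \<subseteq> E \<and> E \<subseteq> S \<times> S) \<and>
     (\<forall>E\<in>U. \<forall>F. E \<subseteq> F \<and> F \<subseteq> S \<times> S \<longrightarrow> F \<in> U) \<and>
     (\<forall>E\<in>U. \<forall>F\<in>U. E \<inter> F \<in> U) \<and>
     (\<forall>E\<in>U. E\<inverse> \<in> U) \<and>
     (\<forall>E\<in>U. \<exists>D\<in>U. D O D \<subseteq> E)"

definition compatible_uniformity :: "'y topology \<Rightarrow> ('y \<times> 'y) set set \<Rightarrow> bool" where
  "compatible_uniformity Y U \<longleftrightarrow>
     uniformity_on_set (topspace Y) U \<and>
     (\<forall>A. openin Y A \<longleftrightarrow> A \<subseteq> topspace Y \<and> (\<forall>y\<in>A. \<exists>E\<in>U. E `` {y} \<subseteq> A))"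

text \<open>
  Existence and uniqueness for compact Hausdorff \<open>Y\<close> are proved below
  (\<open>compatible_uniformity_ex1\<close>).
\<close>

definition compact_uniformity :: "'y topology \<Rightarrow> ('y \<times> 'y) set set" where
  "compact_uniformity Y = (THE U. compatible_uniformity Y U)"

definition SUC_space :: "('g::topological_group_add \<Rightarrow> 'y \<Rightarrow> 'y) \<Rightarrow> 'y topology \<Rightarrow> bool" where
  "SUC_space act Y \<longleftrightarrow>
     compact_space Y \<and> G_space act Y \<and>
     (\<forall>y0\<in>topspace Y. \<forall>E\<in>compact_uniformity Y.
        \<exists>U. open U \<and> 0 \<in> U \<and> (\<forall>g. \<forall>u\<in>U. (act (g + u) y0, act g y0) \<in> E))"

definition SUC_factorization ::
  "('g::topological_group_add \<Rightarrow> 'x \<Rightarrow> 'x) \<Rightarrow> 'x topology \<Rightarrow> ('x \<Rightarrow> real)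
    \<Rightarrow> ('g \<Rightarrow> 'y \<Rightarrow> 'y) \<Rightarrow> 'y topology \<Rightarrow> ('x \<Rightarrow> 'y) \<Rightarrow> ('y \<Rightarrow> real) \<Rightarrow> bool" where
  "SUC_factorization act X f actY Y \<nu> F \<longleftrightarrow>
     SUC_space actY Y \<and>
     continuous_map X Y \<nu> \<and>
     (\<forall>g. \<forall>x\<in>topspace X. \<nu> (act g x) = actY g (\<nu> x)) \<and>
     Y closure_of (\<nu> ` topspace X) = topspace Y \<and>
     continuous_map Y euclideanreal F \<and>
     (\<forall>x\<in>topspace X. f x = F (\<nu> x))"

text \<open>
  HOL cannot quantify over types inside a formula, so the compact space \<open>Y\<close> is taken with points
  in \<open>'x set set\<close>. This is no restriction: a Hausdorff space with a dense image of \<open>X\<close> embeds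
  into that type (send \<open>y\<close> to the family of all \<open>A \<subseteq> X\<close> with \<open>y\<close> in the closure of \<open>\<nu> ` A\<close>), so
  a factorization through a space on any type gives one of this form; see
  \<open>SUC_funsI\<close> below.
\<close>

definition SUC_funs ::
  "('g::topological_group_add \<Rightarrow> 'x \<Rightarrow> 'x) \<Rightarrow> 'x topology \<Rightarrow> ('x \<Rightarrow> real) set" where
  "SUC_funs act X = {f \<in> bounded_cont X.
     \<exists>(actY :: 'g \<Rightarrow> 'x set set \<Rightarrow> 'x set set) Y \<nu> F. SUC_factorization act X f actY Y \<nu> F}"


subsection \<open>The uniformity of a compact Hausdorff space\<close>

lemma
  assumes "uniformity_on_set S U"
  shows uniformity_nonempty: "U \<noteq> {}"
    and uniformity_refl: "E \<in> U \<Longrightarrow> Id_on S \<subseteq> E"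
    and uniformity_subset: "E \<in> U \<Longrightarrow> E \<subseteq> S \<times> S"
    and uniformity_mono: "E \<in> U \<Longrightarrow> E \<subseteq> F \<Longrightarrow> F \<subseteq> S \<times> S \<Longrightarrow> F \<in> U"
    and uniformity_Int: "E \<in> U \<Longrightarrow> F \<in> U \<Longrightarrow> E \<inter> F \<in> U"
    and uniformity_converse: "E \<in> U \<Longrightarrow> E\<inverse> \<in> U"
    and uniformity_half: "E \<in> U \<Longrightarrow> \<exists>D\<in>U. D O D \<subseteq> E"
proof -
  note U = assms[unfolded uniformity_on_set_def]
  show "U \<noteq> {}" using U by (rule conjunct1)
  note U2 = U[THEN conjunct2]
  show "E \<in> U \<Longrightarrow> Id_on S \<subseteq> E" "E \<in> U \<Longrightarrow> E \<subseteq> S \<times> S" using U2[THEN conjunct1] by blast+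
  note U3 = U2[THEN conjunct2]
  show "E \<in> U \<Longrightarrow> E \<subseteq> F \<Longrightarrow> F \<subseteq> S \<times> S \<Longrightarrow> F \<in> U"
    using U3[THEN conjunct1, rule_format, OF _ conjI] .
  note U4 = U3[THEN conjunct2]
  show "E \<in> U \<Longrightarrow> F \<in> U \<Longrightarrow> E \<inter> F \<in> U" using U4[THEN conjunct1, rule_format] .
  note U5 = U4[THEN conjunct2]
  show "E \<in> U \<Longrightarrow> E\<inverse> \<in> U" using U5[THEN conjunct1, rule_format] .
  show "E \<in> U \<Longrightarrow> \<exists>D\<in>U. D O D \<subseteq> E" using U5[THEN conjunct2, rule_format] .
qed

lemma
  assumes "compatible_uniformity Y U"
  shows compatible_uniformityD: "uniformity_on_set (topspace Y) U"
    and compatible_openin: "openin Y A \<longleftrightarrow> A \<subseteq> topspace Y \<and> (\<forall>y\<in>A. \<exists>E\<in>U. E `` {y} \<subseteq> A)"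
  using assms[unfolded compatible_uniformity_def, THEN conjunct1]
    assms[unfolded compatible_uniformity_def, THEN conjunct2, THEN spec, of A] .

lemma uniformity_symD:
  assumes U: "uniformity_on_set S U" and E: "E \<in> U"
  obtains D where "D \<in> U" "D\<inverse> = D" "D O D \<subseteq> E" "D \<subseteq> E" "Id_on S \<subseteq> D" "D \<subseteq> S \<times> S"
proof -
  obtain D where D: "D \<in> U" "D O D \<subseteq> E"
    using uniformity_half[OF U E] by blast
  let ?D = "D \<inter> D\<inverse>"
  have 1: "?D \<in> U" using uniformity_Int[OF U D(1) uniformity_converse[OF U D(1)]] .
  have 2: "Id_on S \<subseteq> ?D" "?D \<subseteq> S \<times> S" using uniformity_refl[OF U 1] uniformity_subset[OF U 1] .
  have 3: "?D O ?D \<subseteq> E" using D(2) by blast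
  have 4: "?D \<subseteq> E"
  proof
    fix p assume p: "p \<in> ?D"
    obtain a b where ab: "p = (a, b)" by fastforce
    have "(a, a) \<in> ?D" using p 2 ab by blast
    then show "p \<in> E" using p ab 3 by blast
  qed
  have 5: "?D\<inverse> = ?D" by blast
  show thesis using that[OF 1 5 3 4 2] .
qed

lemma compatible_interior:
  assumes U: "compatible_uniformity Y U" and D: "D \<in> U"
  obtains V where "openin Y V" "V \<subseteq> D `` {x}" "x \<in> topspace Y \<Longrightarrow> x \<in> V"
proof -
  have un: "uniformity_on_set (topspace Y) U" using compatible_uniformityD[OF U] .
  define V where "V = {y \<in> topspace Y. \<exists>E\<in>U. E `` {y} \<subseteq> D `` {x}}"
  have "openin Y V"
  proof -
    have "\<exists>E\<in>U. E `` {y} \<subseteq> V" if y: "y \<in> V" for y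
    proof -
      obtain E where E: "E \<in> U" "E `` {y} \<subseteq> D `` {x}" using y by (auto simp: V_def)
      obtain D' where D': "D' \<in> U" "D' O D' \<subseteq> E" "D' \<subseteq> topspace Y \<times> topspace Y"
        using uniformity_symD[OF un E(1)] by metis
      have "D' `` {y} \<subseteq> V" unfolding V_def using D' E by blast
      then show ?thesis using D' by blast
    qed
    moreover have "V \<subseteq> topspace Y" by (auto simp: V_def)
    ultimately show ?thesis using compatible_openin[OF U] by simp
  qed
  moreover have "V \<subseteq> D `` {x}"
  proof
    fix y assume "y \<in> V"
    then obtain E where E: "E \<in> U" "E `` {y} \<subseteq> D `` {x}" "y \<in> topspace Y" by (auto simp: V_def)
    then have "(y, y) \<in> E" using uniformity_refl[OF un E(1)] by blast
    then show "y \<in> D `` {x}" using E by blast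
  qed
  moreover have "x \<in> V" if "x \<in> topspace Y" using that D by (auto simp: V_def)
  ultimately show thesis using that by blast
qed

lemma compatible_imp_nbhd_diagonal:
  assumes U: "compatible_uniformity Y U" and E: "E \<in> U"
  shows "\<exists>W. openin (prod_topology Y Y) W \<and> Id_on (topspace Y) \<subseteq> W \<and> W \<subseteq> E"
proof -
  have un: "uniformity_on_set (topspace Y) U" using compatible_uniformityD[OF U] .
  obtain D where D: "D \<in> U" "D\<inverse> = D" "D O D \<subseteq> E" using uniformity_symD[OF un E] by metis
  have "\<forall>x. \<exists>V. openin Y V \<and> V \<subseteq> D `` {x} \<and> (x \<in> topspace Y \<longrightarrow> x \<in> V)"
    using compatible_interior[OF U D(1)] by metis
  then obtain V where V: "\<And>x. openin Y (V x)" "\<And>x. V x \<subseteq> D `` {x}"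
      "\<And>x. x \<in> topspace Y \<Longrightarrow> x \<in> V x" by metis
  let ?W = "\<Union>x\<in>topspace Y. V x \<times> V x"
  have "openin (prod_topology Y Y) ?W" using V(1) by (auto simp: openin_prod_Times_iff)
  moreover have "Id_on (topspace Y) \<subseteq> ?W" using V(3) by blast
  moreover have "?W \<subseteq> E"
  proof
    fix p assume "p \<in> ?W"
    then obtain x a b where p: "p = (a, b)" "(x, a) \<in> D" "(x, b) \<in> D" using V(2) by blast
    then have "(a, x) \<in> D" using D(2) by blast
    then show "p \<in> E" using p D(3) by blast
  qed
  ultimately show ?thesis by blast
qed

lemma open_diagonal_box:
  assumes "openin (prod_topology Y Y) W" "Id_on (topspace Y) \<subseteq> W" "x \<in> topspace Y"
  obtains C where "openin Y C" "x \<in> C" "C \<times> C \<subseteq> W"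
proof -
  have "(x, x) \<in> W" using assms by blast
  then obtain A B where "openin Y A" "openin Y B" "x \<in> A" "x \<in> B" "A \<times> B \<subseteq> W"
    using assms(1) unfolding openin_prod_topology_alt by meson
  then show thesis using that[of "A \<inter> B"] by blast
qed

lemma compact_space_finite_points:
  assumes Y: "compact_space Y" and O: "\<And>x. x \<in> topspace Y \<Longrightarrow> openin Y (V x) \<and> x \<in> V x"
  obtains F where "finite F" "F \<subseteq> topspace Y" "topspace Y \<subseteq> (\<Union>x\<in>F. V x)"
proof -
  have "\<exists>\<F>. finite \<F> \<and> \<F> \<subseteq> V ` topspace Y \<and> topspace Y \<subseteq> \<Union>\<F>"
  proof (rule compactinD[OF Y[unfolded compact_space_def]])
    show "openin Y T" if "T \<in> V ` topspace Y" for T using O that by blast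
    show "topspace Y \<subseteq> \<Union> (V ` topspace Y)" using O by blast
  qed
  then obtain \<F> where \<F>: "finite \<F>" "\<F> \<subseteq> V ` topspace Y" "topspace Y \<subseteq> \<Union>\<F>" by blast
  then obtain F where "F \<subseteq> topspace Y" "finite F" "\<F> = V ` F" by (meson finite_subset_image)
  then show thesis using that \<F>(3) by simp
qed

lemma nbhd_diagonal_imp_compatible:
  assumes Y: "compact_space Y" and U: "compatible_uniformity Y U"
    and W: "openin (prod_topology Y Y) W" "Id_on (topspace Y) \<subseteq> W"
  shows "W \<in> U"
proof -
  let ?S = "topspace Y"
  have un: "uniformity_on_set ?S U" using compatible_uniformityD[OF U] .
  have WS: "W \<subseteq> ?S \<times> ?S" using openin_subset[OF W(1)] by simp
  define P where "P x C D V \<longleftrightarrow> openin Y C \<and> x \<in> C \<and> C \<times> C \<subseteq> W \<and> D \<in> U \<and> (D O D) `` {x} \<subseteq> C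
      \<and> D `` {x} \<subseteq> C \<and> openin Y V \<and> V \<subseteq> D `` {x} \<and> x \<in> V" for x C D V
  have "\<exists>C D V. P x C D V" if x: "x \<in> ?S" for x
  proof -
    obtain C where C: "openin Y C" "x \<in> C" "C \<times> C \<subseteq> W"
      using open_diagonal_box[OF W x] by metis
    obtain E where E: "E \<in> U" "E `` {x} \<subseteq> C"
      using compatible_openin[OF U, of C] C by blast
    obtain D where D: "D \<in> U" "D O D \<subseteq> E" "D \<subseteq> E" using uniformity_symD[OF un E(1)] by metis
    obtain V where V: "openin Y V" "V \<subseteq> D `` {x}" "x \<in> V"
      using compatible_interior[OF U D(1)] x by metis
    have "(D O D) `` {x} \<subseteq> C" "D `` {x} \<subseteq> C" using D E by blast+
    then have "P x C D V" unfolding P_def by (intro conjI C D V)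
    then show ?thesis by blast
  qed
  then obtain C D V where P: "\<And>x. x \<in> ?S \<Longrightarrow> P x (C x) (D x) (V x)" by metis
  note CDV = P[unfolded P_def]
  have OV: "openin Y (V x) \<and> x \<in> V x" if "x \<in> ?S" for x using CDV[OF that] by (elim conjE) (intro conjI)
  obtain F where F: "finite F" "F \<subseteq> ?S" "?S \<subseteq> (\<Union>x\<in>F. V x)"
    by (rule compact_space_finite_points[where V = V, OF Y OV]) assumption+
  have "\<exists>E\<in>U. E \<subseteq> (\<Inter>x\<in>F. D x)" using F(1,2)
  proof (induction F rule: finite_induct)
    case empty
    then show ?case using uniformity_nonempty[OF un] by blast
  next
    case (insert x F)
    then obtain E where E: "E \<in> U" "E \<subseteq> (\<Inter>x\<in>F. D x)" by blast
    have "E \<inter> D x \<in> U" using uniformity_Int[OF un E(1), of "D x"] insert.prems CDV[of x] by simp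
    then show ?case using E by blast
  qed
  then obtain E where E: "E \<in> U" "E \<subseteq> (\<Inter>x\<in>F. D x)" by blast
  have ES: "E \<subseteq> ?S \<times> ?S" using uniformity_subset[OF un E(1)] .
  have "E \<subseteq> W"
  proof
    fix p assume p: "p \<in> E"
    obtain a b where ab: "p = (a, b)" by fastforce
    have "a \<in> ?S" using p ab ES by blast
    then obtain x where x: "x \<in> F" "a \<in> V x" using F by blast
    note cx = CDV[of x]
    have xa: "(x, a) \<in> D x" using cx x F by blast
    have "(a, b) \<in> D x" using E x p ab by blast
    then have "a \<in> C x" "b \<in> C x" using xa cx x F by blast+
    then show "p \<in> W" using cx x F ab by blast
  qed
  then show ?thesis using uniformity_mono[OF un E(1) _ WS] by simp
qed

definition diagonal_nbhds :: "'y topology \<Rightarrow> ('y \<times> 'y) set set" where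
  "diagonal_nbhds Y = {E. E \<subseteq> topspace Y \<times> topspace Y \<and>
     (\<exists>W. openin (prod_topology Y Y) W \<and> Id_on (topspace Y) \<subseteq> W \<and> W \<subseteq> E)}"

lemma diagonal_nbhdsI:
  assumes "openin (prod_topology Y Y) W" "Id_on (topspace Y) \<subseteq> W" "W \<subseteq> E"
    "E \<subseteq> topspace Y \<times> topspace Y"
  shows "E \<in> diagonal_nbhds Y"
  unfolding diagonal_nbhds_def using assms by (intro CollectI conjI exI)

lemma diagonal_nbhdsE:
  assumes "E \<in> diagonal_nbhds Y"
  obtains W where "openin (prod_topology Y Y) W" "Id_on (topspace Y) \<subseteq> W" "W \<subseteq> E"
    "E \<subseteq> topspace Y \<times> topspace Y"
  using assms unfolding diagonal_nbhds_def by (elim CollectE conjE exE) rule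

lemma openin_swap:
  assumes "openin (prod_topology Y Y) W" shows "openin (prod_topology Y Y) (W\<inverse>)"
proof -
  have "continuous_map (prod_topology Y Y) (prod_topology Y Y) (\<lambda>p. (snd p, fst p))"
    by (intro continuous_map_pairedI continuous_map_fst continuous_map_snd)
  from openin_continuous_map_preimage[OF this assms]
  have "openin (prod_topology Y Y) {p \<in> topspace Y \<times> topspace Y. (snd p, fst p) \<in> W}" by simp
  moreover have "{p \<in> topspace Y \<times> topspace Y. (snd p, fst p) \<in> W} = W\<inverse>"
    using openin_subset[OF assms] by auto
  ultimately show ?thesis by simp
qed

lemma diagonal_nbhds_compose:
  assumes Y: "compact_space Y" "Hausdorff_space Y"
    and W: "openin (prod_topology Y Y) W" "Id_on (topspace Y) \<subseteq> W"
  shows "\<exists>D. openin (prod_topology Y Y) D \<and> Id_on (topspace Y) \<subseteq> D \<and> D O D \<subseteq> W"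
proof -
  let ?S = "topspace Y"
  have reg: "regular_space Y" using Y compact_Hausdorff_imp_regular_space by blast
  define P where "P x C K V \<longleftrightarrow> openin Y C \<and> C \<times> C \<subseteq> W \<and> openin Y V \<and> closedin Y K \<and> x \<in> V \<and> V \<subseteq> K \<and> K \<subseteq> C" for x C K V
  have "\<exists>C K V. P x C K V"
    if x: "x \<in> ?S" for x
  proof -
    obtain C where C: "openin Y C" "x \<in> C" "C \<times> C \<subseteq> W" using open_diagonal_box[OF W x] by metis
    then obtain V K where "openin Y V" "closedin Y K" "x \<in> V" "V \<subseteq> K" "K \<subseteq> C"
      using reg unfolding neighbourhood_base_of_closedin[symmetric] neighbourhood_base_of by meson
    then have "P x C K V" unfolding P_def using C by blast
    then show ?thesis by blast
  qed
  then obtain C K V where P: "\<And>x. x \<in> ?S \<Longrightarrow> P x (C x) (K x) (V x)" by metis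
  note CKV = P[unfolded P_def]
  have OV: "openin Y (V x) \<and> x \<in> V x" if "x \<in> ?S" for x using CKV[OF that] by (elim conjE) (intro conjI)
  obtain F where F: "finite F" "F \<subseteq> ?S" "?S \<subseteq> (\<Union>x\<in>F. V x)"
    by (rule compact_space_finite_points[where V = V, OF Y(1) OV]) assumption+
  define B where "B x = C x \<times> C x \<union> (?S - K x) \<times> (?S - K x)" for x
  define D where "D = (?S \<times> ?S) \<inter> (\<Inter>x\<in>F. B x)"
  have B: "openin (prod_topology Y Y) (B x)" if "x \<in> ?S" for x
    unfolding B_def using CKV[OF that] by (intro openin_Un) (auto simp: openin_prod_Times_iff)
  have "openin (prod_topology Y Y) D"
  proof (cases "F = {}")
    case True
    then show ?thesis by (simp add: D_def openin_prod_Times_iff)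
  next
    case False
    then show ?thesis unfolding D_def using F(1,2) B
      by (intro openin_Int openin_INT2) (auto simp: openin_prod_Times_iff)
  qed
  moreover have "Id_on ?S \<subseteq> D"
    unfolding D_def B_def using CKV F(2) by blast
  moreover have "D O D \<subseteq> W"
  proof
    fix p assume "p \<in> D O D"
    then obtain a b c where p: "p = (a, c)" "(a, b) \<in> D" "(b, c) \<in> D" by blast
    then have "b \<in> ?S" by (simp add: D_def)
    then obtain x where x: "x \<in> F" "b \<in> V x" using F by blast
    then have "b \<in> K x" using CKV F by blast
    moreover have "(a, b) \<in> B x" "(b, c) \<in> B x" using p x by (auto simp: D_def)
    ultimately have "a \<in> C x" "c \<in> C x" by (auto simp: B_def)
    then show "p \<in> W" using CKV[of x] x F p by blast
  qed
  ultimately show ?thesis by blast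
qed

lemma compatible_diagonal_nbhds:
  assumes Y: "compact_space Y" "Hausdorff_space Y"
  shows "compatible_uniformity Y (diagonal_nbhds Y)"
  unfolding compatible_uniformity_def
proof (intro conjI allI)
  let ?S = "topspace Y" and ?U = "diagonal_nbhds Y"
  have open_mem: "W \<in> ?U" if "openin (prod_topology Y Y) W" "Id_on ?S \<subseteq> W" for W
    using diagonal_nbhdsI[OF that order_refl] openin_subset[OF that(1)] by simp
  show "uniformity_on_set ?S ?U"
    unfolding uniformity_on_set_def
  proof (intro conjI)
    have "?S \<times> ?S \<in> ?U" by (rule open_mem) (auto simp: openin_prod_Times_iff)
    then show "?U \<noteq> {}" by blast
    show "\<forall>E\<in>?U. Id_on ?S \<subseteq> E \<and> E \<subseteq> ?S \<times> ?S"
    proof (intro ballI conjI)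
      fix E assume "E \<in> ?U"
      then obtain W where W: "Id_on ?S \<subseteq> W" "W \<subseteq> E" "E \<subseteq> ?S \<times> ?S" by (rule diagonal_nbhdsE)
      show "Id_on ?S \<subseteq> E" using W(1,2) by (rule order_trans)
      show "E \<subseteq> ?S \<times> ?S" by fact
    qed
    show "\<forall>E\<in>?U. \<forall>F. E \<subseteq> F \<and> F \<subseteq> ?S \<times> ?S \<longrightarrow> F \<in> ?U"
    proof (intro ballI allI impI, elim conjE)
      fix E F assume "E \<in> ?U" and F: "E \<subseteq> F" "F \<subseteq> ?S \<times> ?S"
      then obtain W where W: "openin (prod_topology Y Y) W" "Id_on ?S \<subseteq> W" "W \<subseteq> E"
        by (elim diagonal_nbhdsE)
      from diagonal_nbhdsI[OF W(1,2) order_trans[OF W(3) F(1)] F(2)] show "F \<in> ?U" .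
    qed
    show "\<forall>E\<in>?U. \<forall>F\<in>?U. E \<inter> F \<in> ?U"
    proof (intro ballI)
      fix E F assume E: "E \<in> ?U" and F: "F \<in> ?U"
      obtain W where W: "openin (prod_topology Y Y) W" "Id_on ?S \<subseteq> W" "W \<subseteq> E" "E \<subseteq> ?S \<times> ?S"
        using E by (rule diagonal_nbhdsE)
      obtain W' where W': "openin (prod_topology Y Y) W'" "Id_on ?S \<subseteq> W'" "W' \<subseteq> F"
        using F by (rule diagonal_nbhdsE)
      show "E \<inter> F \<in> ?U"
        by (rule diagonal_nbhdsI[OF openin_Int[OF W(1) W'(1)]]) (use W W' in auto)
    qed
    show "\<forall>E\<in>?U. E\<inverse> \<in> ?U"
    proof
      fix E assume "E \<in> ?U"
      then obtain W where W: "openin (prod_topology Y Y) W" "Id_on ?S \<subseteq> W" "W \<subseteq> E" "E \<subseteq> ?S \<times> ?S"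
        by (rule diagonal_nbhdsE)
      show "E\<inverse> \<in> ?U"
        by (rule diagonal_nbhdsI[OF openin_swap[OF W(1)]]) (use W in auto)
    qed
    show "\<forall>E\<in>?U. \<exists>D\<in>?U. D O D \<subseteq> E"
    proof
      fix E assume "E \<in> ?U"
      then obtain W where W: "openin (prod_topology Y Y) W" "Id_on ?S \<subseteq> W" "W \<subseteq> E"
        by (rule diagonal_nbhdsE)
      obtain D where D: "openin (prod_topology Y Y) D" "Id_on ?S \<subseteq> D" "D O D \<subseteq> W"
        using diagonal_nbhds_compose[OF Y W(1,2)] by (elim exE conjE)
      show "\<exists>D\<in>?U. D O D \<subseteq> E"
        using order_trans[OF D(3) W(3)] open_mem[OF D(1,2)] by (rule bexI)
    qed
  qed
  fix A
  show "openin Y A \<longleftrightarrow> A \<subseteq> ?S \<and> (\<forall>y\<in>A. \<exists>E\<in>?U. E `` {y} \<subseteq> A)"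
  proof
    assume A: "openin Y A"
    have "\<exists>E\<in>?U. E `` {y} \<subseteq> A" if y: "y \<in> A" for y
    proof -
      let ?E = "A \<times> A \<union> (?S - {y}) \<times> (?S - {y})"
      have "closedin Y {y}"
        using Y(2) A y openin_subset by (metis closedin_Hausdorff_singleton subsetD)
      then have "openin (prod_topology Y Y) ?E"
        using A by (intro openin_Un) (auto simp: openin_prod_Times_iff)
      moreover have "Id_on ?S \<subseteq> ?E" using y by blast
      ultimately have "?E \<in> ?U" by (rule open_mem)
      then show ?thesis by (rule bexI[rotated]) blast
    qed
    then show "A \<subseteq> ?S \<and> (\<forall>y\<in>A. \<exists>E\<in>?U. E `` {y} \<subseteq> A)" using openin_subset[OF A] by blast
  next
    assume A: "A \<subseteq> ?S \<and> (\<forall>y\<in>A. \<exists>E\<in>?U. E `` {y} \<subseteq> A)"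
    show "openin Y A"
    proof (subst openin_subopen, intro ballI)
      fix y assume y: "y \<in> A"
      then obtain E0 where E0: "E0 \<in> ?U" "E0 `` {y} \<subseteq> A" using A by blast
      obtain W where W: "openin (prod_topology Y Y) W" "Id_on ?S \<subseteq> W" "W \<subseteq> E0"
        using E0(1) by (rule diagonal_nbhdsE)
      have yS: "y \<in> ?S" using y A by blast
      obtain C where "openin Y C" "y \<in> C" "C \<times> C \<subseteq> W" using open_diagonal_box[OF W(1,2) yS] by metis
      then show "\<exists>T. openin Y T \<and> y \<in> T \<and> T \<subseteq> A" using W(3) E0(2) by blast
    qed
  qed
qed

lemma compatible_uniformity_eq:
  assumes "compact_space Y" and U: "compatible_uniformity Y U"
  shows "U = diagonal_nbhds Y"
proof
  have un: "uniformity_on_set (topspace Y) U" using compatible_uniformityD[OF U] .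
  show "U \<subseteq> diagonal_nbhds Y"
    using compatible_imp_nbhd_diagonal[OF U] uniformity_subset[OF un] diagonal_nbhdsI
    by (metis subsetI)
  show "diagonal_nbhds Y \<subseteq> U"
    using nbhd_diagonal_imp_compatible[OF assms] uniformity_mono[OF un] diagonal_nbhdsE
    by (metis subsetI)
qed

theorem compatible_uniformity_ex1:
  assumes "compact_space Y" "Hausdorff_space Y"
  shows "\<exists>!U. compatible_uniformity Y U"
  using compatible_diagonal_nbhds[OF assms] compatible_uniformity_eq[OF assms(1)] by blast

lemma compact_uniformity_eq:
  assumes "compact_space Y" "Hausdorff_space Y"
  shows "compact_uniformity Y = diagonal_nbhds Y"
  unfolding compact_uniformity_def
  using compatible_diagonal_nbhds[OF assms] compatible_uniformity_eq[OF assms(1)] by (rule the_equality)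


subsection \<open>Independence of the type carrying the compact space\<close>

lemma G_space_homeomorphic:
  assumes G: "G_space act Y" and h: "homeomorphic_maps Y Z e d"
  shows "G_space (\<lambda>g z. e (act g (d z))) Z"
proof -
  have hom: "Y homeomorphic_space Z" using h homeomorphic_space_def by blast
  have e: "continuous_map Y Z e" and d: "continuous_map Z Y d"
    and ed: "\<And>z. z \<in> topspace Z \<Longrightarrow> e (d z) = z" and de: "\<And>y. y \<in> topspace Y \<Longrightarrow> d (e y) = y"
    using h unfolding homeomorphic_maps_def by auto
  have c: "continuous_map (prod_topology euclidean Y) Y (\<lambda>(g, x). act g x)"
    using G G_space_def by blast
  have dZ: "d z \<in> topspace Y" if "z \<in> topspace Z" for z
    using d that by (auto simp: continuous_map_def Pi_iff)
  have aY: "act g y \<in> topspace Y" if "y \<in> topspace Y" for g y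
    using c that by (auto simp: continuous_map_def Pi_iff)
  have "continuous_map (prod_topology euclidean Z) (prod_topology euclidean Y) (\<lambda>p. (fst p, d (snd p)))"
    using continuous_map_compose[OF continuous_map_snd d, of euclidean] 
    by (intro continuous_map_pairedI) (auto simp: continuous_map_fst o_def)
  then have "continuous_map (prod_topology euclidean Z) Z (e \<circ> ((\<lambda>(g, x). act g x) \<circ> (\<lambda>p. (fst p, d (snd p)))))"
    using c e by (intro continuous_map_compose)
  then have "continuous_map (prod_topology euclidean Z) Z (\<lambda>(g, z). e (act g (d z)))"
    by (simp add: o_def case_prod_unfold)
  moreover have "Tychonoff_space Z"
    using G hom homeomorphic_completely_regular_space homeomorphic_Hausdorff_space
    unfolding G_space_def Tychonoff_space_def by blast
  ultimately show ?thesis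
    using G dZ aY ed de unfolding G_space_def by simp
qed

lemma SUC_space_homeomorphic:
  assumes S: "SUC_space act Y" and h: "homeomorphic_maps Y Z e d"
  shows "SUC_space (\<lambda>g z. e (act g (d z))) Z"
proof -
  have hom: "Y homeomorphic_space Z" using h homeomorphic_space_def by blast
  have e: "continuous_map Y Z e" and d: "continuous_map Z Y d"
    using h unfolding homeomorphic_maps_def by auto
  have GY: "G_space act Y" and cY: "compact_space Y" using S SUC_space_def by blast+
  have GZ: "G_space (\<lambda>g z. e (act g (d z))) Z" using G_space_homeomorphic[OF GY h] .
  have cZ: "compact_space Z" using cY hom homeomorphic_compact_space by blast
  have HY: "Hausdorff_space Y" and HZ: "Hausdorff_space Z"
    using GY GZ unfolding G_space_def Tychonoff_space_def by blast+
  have "\<exists>U. open U \<and> 0 \<in> U \<and> (\<forall>g. \<forall>u\<in>U. (e (act (g + u) (d z)), e (act g (d z))) \<in> E)"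
    if z: "z \<in> topspace Z" and E: "E \<in> compact_uniformity Z" for z E
  proof -
    obtain W where W: "openin (prod_topology Z Z) W" "Id_on (topspace Z) \<subseteq> W" "W \<subseteq> E"
      using E unfolding compact_uniformity_eq[OF cZ HZ] by (rule diagonal_nbhdsE)
    let ?h = "\<lambda>p. (e (fst p), e (snd p))"
    let ?W = "{p \<in> topspace (prod_topology Y Y). ?h p \<in> W}"
    have "continuous_map (prod_topology Y Y) (prod_topology Z Z) ?h"
      using continuous_map_compose[OF continuous_map_fst e, of Y]
        continuous_map_compose[OF continuous_map_snd e, of Y]
      by (intro continuous_map_pairedI) (auto simp: o_def)
    then have "openin (prod_topology Y Y) ?W"
      using W(1) openin_continuous_map_preimage by blast
    moreover have "Id_on (topspace Y) \<subseteq> ?W"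
      using e W(2)[THEN subsetD, OF Id_onI] by (auto simp: continuous_map_def Pi_iff)
    ultimately have "?W \<in> compact_uniformity Y"
      unfolding compact_uniformity_eq[OF cY HY] by (rule diagonal_nbhdsI) auto
    moreover have "d z \<in> topspace Y" using d z by (auto simp: continuous_map_def Pi_iff)
    ultimately obtain U where U: "open U" "0 \<in> U"
      "\<forall>g. \<forall>u\<in>U. (act (g + u) (d z), act g (d z)) \<in> ?W"
      using S unfolding SUC_space_def by meson
    have "(e (act (g + u) (d z)), e (act g (d z))) \<in> E" if "u \<in> U" for g u
      using U(3) that W(3) by auto
    then show ?thesis using U by blast
  qed
  then show ?thesis using GZ cZ unfolding SUC_space_def by blast
qed

lemma SUC_factorization_homeomorphic:
  assumes S: "SUC_factorization act X f actY Y \<nu> F" and h: "homeomorphic_maps Y Z e d"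
  shows "SUC_factorization act X f (\<lambda>g z. e (actY g (d z))) Z (e \<circ> \<nu>) (F \<circ> d)"
proof -
  have e: "continuous_map Y Z e" and d: "continuous_map Z Y d"
    and de: "\<And>y. y \<in> topspace Y \<Longrightarrow> d (e y) = y"
    using h unfolding homeomorphic_maps_def by auto
  have SY: "SUC_space actY Y"
    and \<nu>: "continuous_map X Y \<nu>" and F: "continuous_map Y euclideanreal F"
    and dense: "Y closure_of (\<nu> ` topspace X) = topspace Y"
    using S unfolding SUC_factorization_def by blast+
  have \<nu>Y: "\<nu> x \<in> topspace Y" if "x \<in> topspace X" for x
    using \<nu> that by (auto simp: continuous_map_def Pi_iff)
  have he: "homeomorphic_map Y Z e" using h homeomorphic_maps_map by blast
  have "Z closure_of (e ` (\<nu> ` topspace X)) = e ` (Y closure_of (\<nu> ` topspace X))"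
    by (rule homeomorphic_map_closure_of[OF he]) (use \<nu>Y in blast)
  then have "Z closure_of ((e \<circ> \<nu>) ` topspace X) = topspace Z"
    using dense he by (simp add: image_comp homeomorphic_imp_surjective_map)
  then show ?thesis
    using S SUC_space_homeomorphic[OF SY h] continuous_map_compose[OF \<nu> e]
      continuous_map_compose[OF d F] \<nu>Y de
    unfolding SUC_factorization_def by simp
qed

lemma homeomorphic_image_topology:
  assumes "inj_on e (topspace Y)"
  shows "\<exists>Z d. homeomorphic_maps Y Z e d"
proof -
  let ?d = "inv_into (topspace Y) e"
  let ?Z = "pullback_topology (e ` topspace Y) ?d Y"
  have tZ: "topspace ?Z = e ` topspace Y"
    using assms by (auto simp: topspace_pullback_topology)
  have d: "continuous_map ?Z Y ?d"
    using continuous_map_pullback[OF continuous_map_id, of "e ` topspace Y" ?d Y] by simp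
  have e: "continuous_map Y ?Z e"
  proof (rule continuous_map_pullback')
    show "continuous_map Y Y (?d \<circ> e)"
      by (rule continuous_map_eq[OF continuous_map_id]) (use assms in auto)
  qed blast
  have "homeomorphic_maps Y ?Z e ?d"
    using d e assms tZ unfolding homeomorphic_maps_def by (auto simp: f_inv_into_f)
  then show ?thesis by blast
qed

theorem SUC_funsI:
  fixes act :: "'g::topological_group_add \<Rightarrow> 'x \<Rightarrow> 'x" and Y :: "'y topology"
  assumes f: "f \<in> bounded_cont X" and S: "SUC_factorization act X f actY Y \<nu> F"
  shows "f \<in> SUC_funs act X"
proof -
  define e where "e y = {A. A \<subseteq> topspace X \<and> y \<in> Y closure_of (\<nu> ` A)}" for y
  have \<nu>: "continuous_map X Y \<nu>" and dense: "Y closure_of (\<nu> ` topspace X) = topspace Y"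
    and H: "Hausdorff_space Y"
    using S unfolding SUC_factorization_def SUC_space_def G_space_def Tychonoff_space_def by blast+
  have "inj_on e (topspace Y)"
  proof (rule inj_onI, rule ccontr)
    fix y z assume yz: "y \<in> topspace Y" "z \<in> topspace Y" "e y = e z" "y \<noteq> z"
    obtain U V where UV: "openin Y U" "openin Y V" "y \<in> U" "z \<in> V" "disjnt U V"
      using H yz unfolding Hausdorff_space_def by meson
    let ?A = "{x \<in> topspace X. \<nu> x \<in> U}"
    have "y \<in> Y closure_of (\<nu> ` ?A)"
      unfolding in_closure_of
    proof (intro conjI allI impI)
      fix T assume T: "y \<in> T \<and> openin Y T"
      have "openin Y (T \<inter> U)" "y \<in> T \<inter> U" using T UV by blast+
      moreover have "y \<in> Y closure_of (\<nu> ` topspace X)" using dense yz by blast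
      ultimately obtain w where "w \<in> \<nu> ` topspace X" "w \<in> T \<inter> U" unfolding in_closure_of by blast
      then show "\<exists>w. w \<in> \<nu> ` ?A \<and> w \<in> T" by blast
    qed (use yz in blast)
    then have "?A \<in> e y" by (auto simp: e_def)
    then have "z \<in> Y closure_of (\<nu> ` ?A)" using yz by (auto simp: e_def)
    then obtain w where "w \<in> \<nu> ` ?A" "w \<in> V" using UV unfolding in_closure_of by blast
    then show False using UV by (auto simp: disjnt_def)
  qed
  then obtain Z d where "homeomorphic_maps Y Z e d" using homeomorphic_image_topology by blast
  from SUC_factorization_homeomorphic[OF S this] f show ?thesis
    unfolding SUC_funs_def by blast
qed

end

theory Submission
  imports Defs
begin

text \<open>
  The left uniform continuity of \<open>f\<^sub>\<sharp>(x)\<close> is uniform in \<open>x\<close> because \<open>f \<in> RUC(X)\<close>, so it passes to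
  every \<open>\<omega> \<in> X\<^sub>f\<close>; only right uniform continuity is at stake. On the compact space \<open>X\<^sub>f\<close> the
  entourages are generated by the coordinates, and \<open>(gu\<omega>)(h) - (g\<omega>)(h) = \<omega>(hgu) - \<omega>(hg)\<close>, so SUC at
  \<open>\<omega>\<close> says exactly that \<open>\<omega>\<close> is right uniformly continuous. Finally, if \<open>f = F \<circ> \<nu>\<close> with \<open>Y\<close> SUC,
  then the functions \<open>g \<mapsto> F(gy)\<close> form a compact set containing \<open>f\<^sub>\<sharp>(X)\<close>, hence \<open>X\<^sub>f\<close>, and all of
  them are right uniformly continuous.
\<close>

section \<open>Function spaces, real-valued continuous maps and entourages\<close>

lemma Hausdorff_space_euclidean_fun:
  "Hausdorff_space (euclidean :: ('a \<Rightarrow> 'b::metric_space) topology)"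
  unfolding euclidean_product_topology[symmetric] by (simp add: Hausdorff_space_product_topology)

text \<open>With \<open>closure_minimal\<close>, this bounds \<open>Xf\<close> from above by any
  compact set of functions containing the image of \<open>sharp act f\<close>; it is applied to the
  cube and to a continuous image of \<open>Y\<close>.\<close>

lemma compact_imp_closed_fun:
  fixes S :: "('a \<Rightarrow> 'b::metric_space) set"
  assumes "compact S"
  shows "closed S"
  using compactin_imp_closedin[OF Hausdorff_space_euclidean_fun] assms by fastforce

lemma compact_PiE_UNIV:
  fixes K :: "'b::metric_space set"
  assumes "compact K"
  shows "compact (\<Pi>\<^sub>E _\<in>(UNIV::'a set). K)"
proof -
  have "compactin (product_topology (\<lambda>_. euclidean) UNIV) (\<Pi>\<^sub>E _\<in>(UNIV::'a set). K)"
    using assms by (simp add: compactin_PiE)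
  then show ?thesis by (simp add: euclidean_product_topology)
qed

lemma continuous_map_realI:
  fixes f :: "'a \<Rightarrow> real"
  assumes "\<And>x e. x \<in> topspace X \<Longrightarrow> e > 0 \<Longrightarrow>
    \<exists>U. openin X U \<and> x \<in> U \<and> (\<forall>y\<in>U. \<bar>f y - f x\<bar> < e)"
  shows "continuous_map X euclideanreal f"
  unfolding Met_TC.continuous_map_to_metric[simplified]
  using assms by (fastforce simp: dist_real_def abs_minus_commute)

lemma openin_abs_diff_less:
  assumes "continuous_map Y euclideanreal \<phi>" "continuous_map Y euclideanreal \<psi>"
  shows "openin Y {y \<in> topspace Y. \<bar>\<phi> y - \<psi> y\<bar> < (e::real)}"
proof -
  have "continuous_map Y euclideanreal (\<lambda>y. \<bar>\<phi> y - \<psi> y\<bar>)"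
    using assms by (intro continuous_intros)
  from openin_continuous_map_preimage[OF this, of "{..<e}"] show ?thesis by simp
qed

lemma openin_prod_abs_diff_less:
  fixes \<phi> :: "'y \<Rightarrow> real"
  assumes "continuous_map Y euclideanreal \<phi>"
  shows "openin (prod_topology Y Y) {p \<in> topspace Y \<times> topspace Y. \<bar>\<phi> (fst p) - \<phi> (snd p)\<bar> < e}"
  using openin_abs_diff_less[OF continuous_map_compose[OF continuous_map_fst assms]
      continuous_map_compose[OF continuous_map_snd assms]]
  by (simp add: o_def)

lemma openin_prod_abs_diff_greater:
  fixes \<phi> :: "'y \<Rightarrow> real"
  assumes "continuous_map Y euclideanreal \<phi>"
  shows "openin (prod_topology Y Y) {p \<in> topspace Y \<times> topspace Y. \<bar>\<phi> (fst p) - \<phi> (snd p)\<bar> > e}"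
proof -
  have "continuous_map (prod_topology Y Y) euclideanreal (\<lambda>p. \<bar>\<phi> (fst p) - \<phi> (snd p)\<bar>)"
    using continuous_map_compose[OF continuous_map_fst assms]
      continuous_map_compose[OF continuous_map_snd assms]
    by (intro continuous_intros) (auto simp: o_def)
  from openin_continuous_map_preimage[OF this, of "{e<..}"] show ?thesis by simp
qed

text \<open>The complement of \<open>W\<close> is compact and misses the diagonal, so it is covered
  by the open sets on which some \<psi> i separates the two points by more than a positive
  threshold. A finite subcover yields both the indices \<open>J\<close> and the bound
  \<open>e\<close>.\<close>

lemma separating_family_entourage:
  fixes \<psi> :: "'i \<Rightarrow> 'y \<Rightarrow> real"
  assumes Y: "compact_space Y"
    and \<psi>: "\<And>i. continuous_map Y euclideanreal (\<psi> i)"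
    and sep: "\<And>a b. a \<in> topspace Y \<Longrightarrow> b \<in> topspace Y \<Longrightarrow> a \<noteq> b \<Longrightarrow> \<exists>i. \<psi> i a \<noteq> \<psi> i b"
    and W: "openin (prod_topology Y Y) W" "Id_on (topspace Y) \<subseteq> W"
  shows "\<exists>J e. finite J \<and> e > 0 \<and> (\<forall>a\<in>topspace Y. \<forall>b\<in>topspace Y.
    (\<forall>i\<in>J. \<bar>\<psi> i a - \<psi> i b\<bar> < e) \<longrightarrow> (a, b) \<in> W)"
proof -
  let ?S = "topspace Y"
  define A where "A = (\<lambda>(i, e). {p \<in> ?S \<times> ?S. \<bar>\<psi> i (fst p) - \<psi> i (snd p)\<bar> > e})"
  define I where "I = (UNIV :: 'i set) \<times> {0::real<..}"
  have "compactin (prod_topology Y Y) (?S \<times> ?S - W)"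
  proof (rule closedin_compact_space)
    show "compact_space (prod_topology Y Y)" using Y by (simp add: compact_space_prod_topology)
    show "closedin (prod_topology Y Y) (?S \<times> ?S - W)"
      using closedin_diff[OF closedin_topspace W(1)] by simp
  qed
  moreover have "openin (prod_topology Y Y) T" if "T \<in> A ` I" for T
    using that openin_prod_abs_diff_greater[OF \<psi>] by (auto simp: A_def)
  moreover have "?S \<times> ?S - W \<subseteq> \<Union> (A ` I)"
  proof clarify
    fix a b assume ab: "(a, b) \<notin> W" "a \<in> ?S" "b \<in> ?S"
    then have "a \<noteq> b" using W(2) by blast
    then obtain i where "\<psi> i a \<noteq> \<psi> i b" using sep ab by blast
    then have "(a, b) \<in> A (i, \<bar>\<psi> i a - \<psi> i b\<bar> / 2)" "(i, \<bar>\<psi> i a - \<psi> i b\<bar> / 2) \<in> I"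
      using ab by (auto simp: A_def I_def)
    then show "(a, b) \<in> \<Union> (A ` I)" by blast
  qed
  ultimately obtain \<F> where "finite \<F>" "\<F> \<subseteq> A ` I" "?S \<times> ?S - W \<subseteq> \<Union>\<F>"
    using compactinD by metis
  then obtain K where K: "finite K" "K \<subseteq> I" "?S \<times> ?S - W \<subseteq> \<Union> (A ` K)"
    using finite_subset_image[of \<F> A I] by blast
  \<comment> \<open>The inserted 1 keeps the minimum meaningful and positive when \<open>K\<close>
    is empty, which can happen if \<open>W\<close> is the whole square.\<close>
  let ?e = "Min (insert 1 (snd ` K))"
  show ?thesis
  proof (intro exI conjI ballI impI)
    show "finite (fst ` K)" using K by simp
    show "?e > 0" using K by (auto simp: I_def)
    fix a b assume ab: "a \<in> ?S" "b \<in> ?S" "\<forall>i\<in>fst ` K. \<bar>\<psi> i a - \<psi> i b\<bar> < ?e"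
    show "(a, b) \<in> W"
    proof (rule ccontr)
      assume "(a, b) \<notin> W"
      then obtain i e where ie: "(i, e) \<in> K" "\<bar>\<psi> i a - \<psi> i b\<bar> > e"
        using K(3) ab by (fastforce simp: A_def)
      have "?e \<le> e" using ie K(1) by (intro Min_le) force+
      then show False using ie ab by force
    qed
  qed
qed

section \<open>G-spaces and the SUC condition in terms of real functions\<close>

lemma G_space_in_topspace:
  assumes "G_space act X" "x \<in> topspace X"
  shows "act g x \<in> topspace X"
  using assms unfolding G_space_def by (auto simp: continuous_map_def Pi_iff)

lemma G_space_continuous_act:
  assumes "G_space act X"
  shows "continuous_map X X (act g)"
proof -
  have "continuous_map X (prod_topology euclidean X) (\<lambda>x. (g, x))"
    by (intro continuous_map_pairedI) auto
  moreover have "continuous_map (prod_topology euclidean X) X (\<lambda>(g, x). act g x)"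
    using assms unfolding G_space_def by blast
  ultimately show ?thesis
    using continuous_map_compose by (fastforce simp: o_def)
qed

text \<open>The pairs on which \<open>F\<close> differs by less than \<open>e\<close> form an open
  neighborhood of the diagonal, hence an entourage to which the SUC condition applies.\<close>

lemma SUC_space_eventually:
  fixes act :: "'g::topological_group_add \<Rightarrow> 'y \<Rightarrow> 'y" and F :: "'y \<Rightarrow> real"
  assumes S: "SUC_space act Y" and F: "continuous_map Y euclideanreal F"
    and y: "y \<in> topspace Y" and e: "e > 0"
  shows "\<forall>\<^sub>F u in nhds 0. \<forall>g. \<bar>F (act (g + u) y) - F (act g y)\<bar> < e"
proof -
  have Y: "compact_space Y" "Hausdorff_space Y"
    using S unfolding SUC_space_def G_space_def Tychonoff_space_def by blast+
  let ?E = "{p \<in> topspace Y \<times> topspace Y. \<bar>F (fst p) - F (snd p)\<bar> < e}"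
  have "?E \<in> compact_uniformity Y"
    unfolding compact_uniformity_eq[OF Y]
    by (rule diagonal_nbhdsI[OF openin_prod_abs_diff_less[OF F]]) (use e in auto)
  then obtain U where "open U" "0 \<in> U" "\<forall>g. \<forall>u\<in>U. (act (g + u) y, act g y) \<in> ?E"
    using S y unfolding SUC_space_def by meson
  then show ?thesis unfolding eventually_nhds by auto
qed

text \<open>Every entourage is controlled by finitely many members of a separating family, and the
  finitely many corresponding neighborhoods of 0 intersect in one. So SUC need only be tested on
  such a family; for \<open>Xf\<close> it will be the coordinate evaluations.\<close>

lemma SUC_spaceI:
  fixes act :: "'g::topological_group_add \<Rightarrow> 'y \<Rightarrow> 'y" and \<psi> :: "'i \<Rightarrow> 'y \<Rightarrow> real"
  assumes Y: "compact_space Y" and G: "G_space act Y"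
    and \<psi>: "\<And>i. continuous_map Y euclideanreal (\<psi> i)"
    and sep: "\<And>a b. a \<in> topspace Y \<Longrightarrow> b \<in> topspace Y \<Longrightarrow> a \<noteq> b \<Longrightarrow> \<exists>i. \<psi> i a \<noteq> \<psi> i b"
    and ev: "\<And>i y e. y \<in> topspace Y \<Longrightarrow> e > 0 \<Longrightarrow>
      \<forall>\<^sub>F u in nhds 0. \<forall>g. \<bar>\<psi> i (act (g + u) y) - \<psi> i (act g y)\<bar> < e"
  shows "SUC_space act Y"
proof -
  have H: "Hausdorff_space Y" using G unfolding G_space_def Tychonoff_space_def by blast
  have "\<exists>U. open U \<and> 0 \<in> U \<and> (\<forall>g. \<forall>u\<in>U. (act (g + u) y, act g y) \<in> E)"
    if y: "y \<in> topspace Y" and E: "E \<in> compact_uniformity Y" for y E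
  proof -
    obtain W where W: "openin (prod_topology Y Y) W" "Id_on (topspace Y) \<subseteq> W" "W \<subseteq> E"
      using E unfolding compact_uniformity_eq[OF Y H] by (rule diagonal_nbhdsE)
    obtain J e where J: "finite J" "e > 0"
      "\<forall>a\<in>topspace Y. \<forall>b\<in>topspace Y. (\<forall>i\<in>J. \<bar>\<psi> i a - \<psi> i b\<bar> < e) \<longrightarrow> (a, b) \<in> W"
      using separating_family_entourage[where \<psi> = \<psi>, OF Y \<psi> sep W(1,2)] by blast
    have "\<forall>\<^sub>F u in nhds 0. \<forall>i\<in>J. \<forall>g. \<bar>\<psi> i (act (g + u) y) - \<psi> i (act g y)\<bar> < e"
      using ev[OF y J(2)] J(1) by (simp add: eventually_ball_finite)
    then obtain U where U: "open U" "0 \<in> U"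
      "\<forall>u\<in>U. \<forall>i\<in>J. \<forall>g. \<bar>\<psi> i (act (g + u) y) - \<psi> i (act g y)\<bar> < e"
      unfolding eventually_nhds by auto
    then have "\<forall>g. \<forall>u\<in>U. (act (g + u) y, act g y) \<in> E"
      using J(3) W(3) G_space_in_topspace[OF G y] by blast
    then show ?thesis using U by blast
  qed
  then show ?thesis using Y G unfolding SUC_space_def by blast
qed

section \<open>The supremum norm and uniform continuity on the group\<close>

lemma abs_le_sup_norm:
  assumes "bounded (f ` topspace X)" "x \<in> topspace X"
  shows "\<bar>f x\<bar> \<le> sup_norm X f"
proof -
  have "bdd_above ((\<lambda>x. \<bar>f x\<bar>) ` topspace X)"
    using assms(1) by (force simp: bounded_iff bdd_above_def)
  then show ?thesis unfolding sup_norm_def using assms(2) by (intro cSup_upper) auto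
qed

lemma sup_norm_le:
  assumes "c \<ge> 0" "\<And>x. x \<in> topspace X \<Longrightarrow> \<bar>f x\<bar> \<le> c"
  shows "sup_norm X f \<le> c"
  unfolding sup_norm_def using assms by (intro cSup_least) auto

lemma UC_right:
  assumes "f \<in> UC" "e > 0"
  shows "\<forall>\<^sub>F v in nhds 0. \<forall>g. \<bar>f (g + v) - f g\<bar> < e"
proof -
  have b: "bounded (range f)" using assms unfolding UC_def bounded_cont_def by simp
  have "\<bar>f (g + v) - f g\<bar> \<le> sup_norm euclidean (\<lambda>g. f (g + v) - f g)" for g v
  proof -
    have "bounded ((\<lambda>g. f (g + v) - f g) ` UNIV)"
      by (intro bounded_minus_comp b bounded_subset[OF b]) auto
    then show ?thesis using abs_le_sup_norm[of "\<lambda>g. f (g + v) - f g" euclidean g] by simp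
  qed
  moreover have "\<forall>\<^sub>F v in nhds 0. sup_norm euclidean (\<lambda>g. f (g + v) - f g) < e"
    using assms unfolding UC_def by (auto elim: eventually_mono)
  ultimately show ?thesis by (fastforce elim: eventually_mono intro: le_less_trans)
qed

lemma filterlim_minus_nhds_0:
  fixes g :: "'g::topological_group_add"
  shows "filterlim (\<lambda>x. x - g) (nhds 0) (nhds g)"
proof -
  have "((\<lambda>x. x + (- g)) \<longlongrightarrow> g + (- g)) (nhds g)"
    by (intro tendsto_add tendsto_const filterlim_ident)
  then show ?thesis by simp
qed

text \<open>Weak inequalities are assumed because the left estimate on \<open>Xf\<close> comes from
  a closed condition; using them at \<open>e / 2\<close> restores strictness. Continuity follows
  from the left estimate alone, writing x = (x - g) + g.\<close>

lemma UC_I: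
  fixes f :: "'g::topological_group_add \<Rightarrow> real"
  assumes b: "bounded (range f)"
    and l: "\<And>e. e > 0 \<Longrightarrow> \<forall>\<^sub>F v in nhds 0. \<forall>g. \<bar>f (v + g) - f g\<bar> \<le> e"
    and r: "\<And>e. e > 0 \<Longrightarrow> \<forall>\<^sub>F v in nhds 0. \<forall>g. \<bar>f (g + v) - f g\<bar> \<le> e"
  shows "f \<in> UC"
proof -
  have "(f \<longlongrightarrow> f g) (nhds g)" for g
  proof (rule tendstoI)
    fix e :: real assume e: "e > 0"
    then have "\<forall>\<^sub>F v in nhds 0. \<forall>g. \<bar>f (v + g) - f g\<bar> \<le> e / 2" by (intro l) simp
    from eventually_compose_filterlim[OF this filterlim_minus_nhds_0[of g]]
    have "\<forall>\<^sub>F x in nhds g. \<bar>f (x - g + g) - f g\<bar> \<le> e / 2" by eventually_elim blast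
    then show "\<forall>\<^sub>F x in nhds g. dist (f x) (f g) < e"
      by eventually_elim (use e in \<open>simp add: dist_real_def\<close>)
  qed
  then have "continuous_on UNIV f"
    by (simp add: continuous_on_def tendsto_within_subset tendsto_mono[OF at_le] at_within_def
        tendsto_mono[OF inf_le1])
  moreover have "\<forall>\<^sub>F v in nhds 0. sup_norm euclidean (\<lambda>g. f (v + g) - f g) < e \<and>
       sup_norm euclidean (\<lambda>g. f (g + v) - f g) < e" if e: "e > 0" for e
  proof -
    have e2: "e / 2 > 0" using e by simp
    show ?thesis
      using l[OF e2] r[OF e2]
    proof eventually_elim
      case (elim v)
      have "sup_norm euclidean (\<lambda>g. f (v + g) - f g) \<le> e / 2"
        "sup_norm euclidean (\<lambda>g. f (g + v) - f g) \<le> e / 2"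
        using elim e by (intro sup_norm_le; simp)+
      then show ?case using e by linarith
    qed
  qed
  ultimately show ?thesis using b unfolding UC_def bounded_cont_def by simp
qed

text \<open>This is norm continuity of the orbit map at the neutral element, read pointwise.\<close>

lemma RUC_left_uniform:
  assumes G: "G_space act X" and f: "f \<in> RUC act X" and e: "e > 0"
  shows "\<forall>\<^sub>F v in nhds 0. \<forall>x\<in>topspace X. \<bar>f (act v x) - f x\<bar> < e"
proof -
  let ?d = "\<lambda>g x. f (act g x) - f (act 0 x)"
  have b: "bounded (f ` topspace X)" using f unfolding RUC_def bounded_cont_def by simp
  have "((\<lambda>g. sup_norm X (?d g)) \<longlongrightarrow> 0) (nhds 0)" using f unfolding RUC_def by blast
  from order_tendstoD(2)[OF this e] show ?thesis
  proof eventually_elim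
    case (elim v)
    show ?case
    proof
      fix x assume x: "x \<in> topspace X"
      have "bounded (?d v ` topspace X)"
        using G_space_in_topspace[OF G]
        by (intro bounded_minus_comp bounded_subset[OF b]) auto
      from abs_le_sup_norm[OF this x] elim show "\<bar>f (act v x) - f x\<bar> < e"
        using G x unfolding G_space_def by simp
    qed
  qed
qed

section \<open>The compact G-space \<open>Xf\<close>\<close>

context
  fixes act :: "'g::topological_group_add \<Rightarrow> 'x \<Rightarrow> 'x"
    and X :: "'x topology" and f :: "'x \<Rightarrow> real"
  assumes G: "G_space act X" and f: "f \<in> RUC act X"
begin

text \<open>The closure is taken in the space of all functions on the group, so that the type class
  topology is available; \<open>X_sub_eq\<close> identifies the result with the closure inside
  \<open>Omega X f\<close>.\<close>

abbreviation "Xf \<equiv> closure (sharp act f ` topspace X)"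

lemma sharp_image_subset_cube:
  "sharp act f ` topspace X \<subseteq> (\<Pi>\<^sub>E _\<in>UNIV. {- sup_norm X f .. sup_norm X f})"
proof -
  have "bounded (f ` topspace X)" using f unfolding RUC_def bounded_cont_def by simp
  from abs_le_sup_norm[OF this G_space_in_topspace[OF G]]
  have "f (act g x) \<in> {- sup_norm X f .. sup_norm X f}" if "x \<in> topspace X" for g x
    using that unfolding atLeastAtMost_iff abs_le_iff by (metis minus_le_iff)
  then show ?thesis by (auto simp: sharp_def simp del: atLeastAtMost_iff)
qed

lemma Xf_subset_cube: "Xf \<subseteq> (\<Pi>\<^sub>E _\<in>UNIV. {- sup_norm X f .. sup_norm X f})"
  using sharp_image_subset_cube 
  by (intro closure_minimal compact_imp_closed_fun compact_PiE_UNIV compact_Icc)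

text \<open>The cube carries the subspace topology of the full product and contains
  \<open>Xf\<close>, so closure and subspace topology are the same in both.\<close>

lemma X_sub_eq: "X_sub act X f = top_of_set Xf"
proof -
  let ?C = "\<Pi>\<^sub>E _\<in>(UNIV::'g set). {- sup_norm X f .. sup_norm X f}"
  have \<Omega>: "Omega X f = top_of_set ?C"
    unfolding Omega_def subtopology_product_topology[symmetric] euclidean_product_topology ..
  have "top_of_set ?C closure_of (sharp act f ` topspace X) = Xf"
    using sharp_image_subset_cube Xf_subset_cube
    by (simp add: closure_of_subtopology Int_absorb1)
  then show ?thesis
    using Xf_subset_cube unfolding X_sub_def \<Omega>
    by (simp add: subtopology_subtopology Int_absorb1)
qed

lemma compact_Xf: "compact Xf"
proof -
  have "compact (\<Pi>\<^sub>E _\<in>(UNIV::'g set). {- sup_norm X f .. sup_norm X f})"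
    by (intro compact_PiE_UNIV compact_Icc)
  from compact_Int_closed[OF this closed_closure] show ?thesis
    using Xf_subset_cube by (metis inf.absorb2)
qed

text \<open>For fixed \<open>v\<close> the weak estimate is a closed condition in the pointwise
  topology. One \<open>v\<close> serves all points of \<open>X\<close> by
  \<open>RUC_left_uniform\<close>, hence all of the closure.\<close>

lemma Xf_left_uniform:
  assumes "e > 0"
  shows "\<forall>\<^sub>F v in nhds 0. \<forall>\<omega>\<in>Xf. \<forall>g. \<bar>\<omega> (v + g) - \<omega> g\<bar> \<le> e"
  using RUC_left_uniform[OF G f assms]
proof eventually_elim
  case (elim v)
  let ?C = "{\<omega> :: 'g \<Rightarrow> real. \<forall>g. \<bar>\<omega> (v + g) - \<omega> g\<bar> \<le> e}"
  have "Xf \<subseteq> ?C"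
  proof (rule closure_minimal)
    show "closed ?C"
      by (intro closed_Collect_all closed_Collect_le continuous_intros
          continuous_on_product_coordinates)
    show "sharp act f ` topspace X \<subseteq> ?C"
    proof clarify
      fix x g assume x: "x \<in> topspace X"
      have "act (v + g) x = act v (act g x)" using G x unfolding G_space_def by blast
      then show "\<bar>sharp act f x (v + g) - sharp act f x g\<bar> \<le> e"
        using elim G_space_in_topspace[OF G x] by (simp add: sharp_def less_imp_le)
    qed
  qed
  then show ?case by blast
qed

lemma shift_sharp:
  assumes "x \<in> topspace X"
  shows "shift g (sharp act f x) = sharp act f (act g x)"
  using G assms unfolding G_space_def by (simp add: shift_def sharp_def)

text \<open>Each coordinate of \<open>shift g\<close> is an evaluation, so \<open>shift g\<close> is
  continuous; it maps the image of \<open>X\<close> into itself by equivariance, hence also its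
  closure.\<close>

lemma shift_Xf:
  assumes "\<omega> \<in> Xf" shows "shift g \<omega> \<in> Xf"
proof -
  have "continuous_on UNIV (shift g :: ('g \<Rightarrow> real) \<Rightarrow> 'g \<Rightarrow> real)"
    unfolding shift_def
    by (intro continuous_on_coordinatewise_then_product continuous_on_product_coordinates)
  moreover have "shift g ` sharp act f ` topspace X \<subseteq> Xf"
    using shift_sharp G_space_in_topspace[OF G]
    by (intro order_trans[OF _ closure_subset]) auto
  ultimately have "shift g ` Xf \<subseteq> Xf"
    by (intro image_closure_subset) (auto intro: continuous_on_subset)
  then show ?thesis using assms by blast
qed

lemma continuous_map_eval: "continuous_map (top_of_set Xf) euclideanreal (\<lambda>\<omega>. \<omega> h)"
  by (auto intro: continuous_on_subset[OF continuous_on_product_coordinates])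

lemma continuous_map_into_Xf:
  assumes "\<And>h. continuous_map Z euclideanreal (\<lambda>z. \<Phi> z h)" "\<And>z. z \<in> topspace Z \<Longrightarrow> \<Phi> z \<in> Xf"
  shows "continuous_map Z (top_of_set Xf) \<Phi>"
  using assms continuous_map_componentwise_UNIV[of Z "\<lambda>_. euclideanreal" \<Phi>]
  by (auto simp: continuous_map_in_subtopology euclidean_product_topology)

text \<open>Joint continuity is checked in each coordinate \<open>h\<close>. Moving \<open>g\<close>
  to \<open>g0\<close> costs little uniformly over \<open>Xf\<close> by left uniformity, and moving
  \<omega> to \<omega>0 is then continuity of evaluation at \<open>h + g0\<close>.\<close>

lemma G_space_Xf: "G_space shift (top_of_set Xf)"
proof -
  let ?Y = "top_of_set Xf"
  have H: "Hausdorff_space ?Y" by (intro Hausdorff_space_subtopology Hausdorff_space_euclidean_fun)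
  have K: "compact_space ?Y" using compact_Xf by (simp add: compact_space_subtopology)
  have "Tychonoff_space ?Y"
    unfolding Tychonoff_space_def
    using H K by (simp add: compact_Hausdorff_or_regular_imp_normal_space
        normal_imp_completely_regular_space)
  moreover have "continuous_map (prod_topology euclidean ?Y) ?Y (\<lambda>(g, \<omega>). shift g \<omega>)"
  proof (rule continuous_map_into_Xf)
    fix h :: 'g
    show "continuous_map (prod_topology euclidean ?Y) euclideanreal (\<lambda>z. (case z of (g, \<omega>) \<Rightarrow> shift g \<omega>) h)"
    proof (rule continuous_map_realI, clarsimp simp: shift_def)
      fix g0 :: 'g and \<omega>0 e assume \<omega>0: "\<omega>0 \<in> Xf" and e: "(e::real) > 0"
      \<comment> \<open>The conjugate \<open>h + (g - g0) - h\<close> is the left translation taking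
        \<open>h + g0\<close> to \<open>h + g\<close>; conjugating is necessary since the group may
        be noncommutative.\<close>
      have lim: "filterlim (\<lambda>g. h + (g - g0) - h) (nhds 0) (nhds g0)"
      proof -
        have "((\<lambda>g. h + (g - g0) + (- h)) \<longlongrightarrow> h + 0 + (- h)) (nhds g0)"
          by (intro tendsto_add tendsto_const filterlim_minus_nhds_0)
        then show ?thesis by simp
      qed
      have "\<forall>\<^sub>F v in nhds 0. \<forall>\<omega>\<in>Xf. \<forall>g. \<bar>\<omega> (v + g) - \<omega> g\<bar> \<le> e / 2"
        by (intro Xf_left_uniform) (use e in simp)
      from eventually_compose_filterlim[OF this lim]
      have "\<forall>\<^sub>F g in nhds g0. \<forall>\<omega>\<in>Xf. \<bar>\<omega> (h + g) - \<omega> (h + g0)\<bar> \<le> e / 2"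
      proof eventually_elim
        case (elim g)
        have "h + (g - g0) - h + (h + g0) = h + g"
          by (simp only: diff_conv_add_uminus add.assoc minus_add_cancel left_minus add_0_right)
        then show ?case using elim by metis
      qed
      then obtain U where U: "open U" "g0 \<in> U"
        "\<And>g \<omega>. g \<in> U \<Longrightarrow> \<omega> \<in> Xf \<Longrightarrow> \<bar>\<omega> (h + g) - \<omega> (h + g0)\<bar> \<le> e / 2"
        unfolding eventually_nhds by auto
      let ?V = "{\<omega> \<in> topspace ?Y. \<bar>\<omega> (h + g0) - \<omega>0 (h + g0)\<bar> < e / 2}"
      have "openin ?Y ?V"
        by (rule openin_abs_diff_less[OF continuous_map_eval]) simp
      then have "openin (prod_topology euclidean ?Y) (U \<times> ?V)"
        using U by (simp add: openin_prod_Times_iff)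
      moreover have "(g0, \<omega>0) \<in> U \<times> ?V" using U \<omega>0 e by simp
      moreover have "\<bar>\<omega> (h + g) - \<omega>0 (h + g0)\<bar> < e" if "(g, \<omega>) \<in> U \<times> ?V" for g \<omega>
      proof -
        have "\<bar>\<omega> (h + g) - \<omega> (h + g0)\<bar> \<le> e / 2" "\<bar>\<omega> (h + g0) - \<omega>0 (h + g0)\<bar> < e / 2"
          using U(3)[of g \<omega>] that by auto
        then show ?thesis by arith
      qed
      ultimately show "\<exists>U. openin (prod_topology euclidean ?Y) U \<and> (g0, \<omega>0) \<in> U \<and>
          (\<forall>z\<in>U. \<bar>(case z of (g, \<omega>) \<Rightarrow> \<lambda>h. \<omega> (h + g)) h - \<omega>0 (h + g0)\<bar> < e)"
        by (intro exI[of _ "U \<times> ?V"]) auto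
    qed
  qed (use shift_Xf in auto)
  moreover have "shift 0 \<omega> = \<omega>" "shift (g + h) \<omega> = shift g (shift h \<omega>)"
    for g h :: 'g and \<omega> :: "'g \<Rightarrow> real"
    by (simp_all add: shift_def add.assoc)
  ultimately show ?thesis unfolding G_space_def by simp
qed

section \<open>Uniform continuity, SUC and factorizations\<close>

lemma Xf_UC_iff:
  assumes \<omega>: "\<omega> \<in> Xf"
  shows "\<omega> \<in> UC \<longleftrightarrow> (\<forall>e>0. \<forall>\<^sub>F u in nhds 0. \<forall>g. \<bar>\<omega> (g + u) - \<omega> g\<bar> < e)"
proof
  \<comment> \<open>Boundedness comes from the cube and the left half from
    \<open>Xf_left_uniform\<close>, so \<open>R\<close> only has to supply the right half.\<close>
  assume R: "\<forall>e>0. \<forall>\<^sub>F u in nhds 0. \<forall>g. \<bar>\<omega> (g + u) - \<omega> g\<bar> < e"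
  show "\<omega> \<in> UC"
  proof (rule UC_I)
    have "\<omega> g \<in> {- sup_norm X f .. sup_norm X f}" for g
      using \<omega> Xf_subset_cube by blast
    then show "bounded (range \<omega>)"
      by (intro bounded_subset[OF bounded_closed_interval[of "- sup_norm X f" "sup_norm X f"]]) blast
  next
    fix e :: real assume e: "e > 0"
    show "\<forall>\<^sub>F v in nhds 0. \<forall>g. \<bar>\<omega> (v + g) - \<omega> g\<bar> \<le> e"
      using Xf_left_uniform[OF e] by eventually_elim (use \<omega> in blast)
    have "\<forall>\<^sub>F u in nhds 0. \<forall>g. \<bar>\<omega> (g + u) - \<omega> g\<bar> < e" using R e by blast
    then show "\<forall>\<^sub>F v in nhds 0. \<forall>g. \<bar>\<omega> (g + v) - \<omega> g\<bar> \<le> e"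
      by eventually_elim (simp add: less_imp_le)
  qed
qed (use UC_right in blast)

text \<open>Evaluations separate functions, so \<open>SUC_spaceI\<close> applies. At coordinate
  \<open>h\<close> the condition is the right estimate for \<omega> at the point
  \<open>h + g\<close>, after regrouping \<open>h + (g + u)\<close>.\<close>

lemma SUC_space_Xf_if_UC:
  assumes "Xf \<subseteq> UC"
  shows "SUC_space shift (top_of_set Xf)"
proof (rule SUC_spaceI[OF _ G_space_Xf continuous_map_eval])
  show "compact_space (top_of_set Xf)" using compact_Xf by (simp add: compact_space_subtopology)
  fix h :: 'g and \<omega> e assume \<omega>: "\<omega> \<in> topspace (top_of_set Xf)" and e: "(e::real) > 0"
  have "\<forall>\<^sub>F u in nhds 0. \<forall>g. \<bar>\<omega> (g + u) - \<omega> g\<bar> < e" using UC_right[OF _ e] assms \<omega> by auto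
  then show "\<forall>\<^sub>F u in nhds 0. \<forall>g. \<bar>shift (g + u) \<omega> h - shift g \<omega> h\<bar> < e"
    by eventually_elim (simp add: shift_def flip: add.assoc)
qed auto

text \<open>\<open>Xf\<close> itself is the factor, with \<open>sharp act f\<close> as the dense
  equivariant map and evaluation at the neutral element as the real function.
  \<open>SUC_funsI\<close> transfers this to the type demanded by \<open>SUC_funs\<close>.\<close>

lemma SUC_funs_if_SUC_space_Xf:
  assumes "SUC_space shift (top_of_set Xf)"
  shows "f \<in> SUC_funs act X"
proof (rule SUC_funsI)
  show bc: "f \<in> bounded_cont X" using f unfolding RUC_def by blast
  have "continuous_map X (top_of_set Xf) (sharp act f)"
  proof (rule continuous_map_into_Xf)
    fix h
    have "continuous_map X euclideanreal f" using bc unfolding bounded_cont_def by blast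
    from continuous_map_compose[OF G_space_continuous_act[OF G] this]
    show "continuous_map X euclideanreal (\<lambda>x. sharp act f x h)" by (simp add: sharp_def o_def)
  qed (rule subsetD[OF closure_subset imageI])
  moreover have "top_of_set Xf closure_of (sharp act f ` topspace X) = Xf"
    using closure_subset[of "sharp act f ` topspace X"]
    by (simp add: closure_of_subtopology Int_absorb1)
  moreover have "f x = sharp act f x 0" if "x \<in> topspace X" for x
    using G that unfolding G_space_def by (simp add: sharp_def)
  ultimately show "SUC_factorization act X f shift (top_of_set Xf) (sharp act f) (\<lambda>\<omega>. \<omega> 0)"
    unfolding SUC_factorization_def
    using assms continuous_map_eval[of 0] shift_sharp by simp
qed

text \<open>The orbit functions of \<open>F\<close> on \<open>Y\<close> form a compact set that
  contains \<open>Xf\<close>. Each element of \<open>Xf\<close> is therefore the orbit function of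
  one point of \<open>Y\<close>, and SUC at that point is its right uniform continuity.\<close>

lemma Xf_UC_if_SUC_factorization:
  assumes S: "SUC_factorization act X f actY Y \<nu> F"
  shows "Xf \<subseteq> UC"
proof
  have SY: "SUC_space actY Y" and \<nu>: "continuous_map X Y \<nu>" and F: "continuous_map Y euclideanreal F"
    and eq: "\<And>g x. x \<in> topspace X \<Longrightarrow> \<nu> (act g x) = actY g (\<nu> x)"
    and fF: "\<And>x. x \<in> topspace X \<Longrightarrow> f x = F (\<nu> x)"
    using S unfolding SUC_factorization_def by blast+
  have GY: "G_space actY Y" and KY: "compactin Y (topspace Y)"
    using SY unfolding SUC_space_def compact_space_def by blast+
  define \<Phi> where "\<Phi> = sharp actY F"
  have "continuous_map Y (product_topology (\<lambda>_. euclideanreal) UNIV) \<Phi>"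
    unfolding continuous_map_componentwise_UNIV
    using continuous_map_compose[OF G_space_continuous_act[OF GY] F]
    by (simp add: \<Phi>_def sharp_def o_def)
  then have "compact (\<Phi> ` topspace Y)"
    using image_compactin[OF KY] unfolding euclidean_product_topology by (metis compactin_euclidean_iff)
  moreover have "sharp act f ` topspace X \<subseteq> \<Phi> ` topspace Y"
  proof clarify
    fix x assume x: "x \<in> topspace X"
    \<comment> \<open>Equivariance of \<nu> turns \<open>f (act g x)\<close> into
      \<open>F (actY g (\<nu> x))\<close>.\<close>
    have "sharp act f x = \<Phi> (\<nu> x)"
      using x eq fF G_space_in_topspace[OF G x] by (simp add: \<Phi>_def sharp_def)
    moreover have "\<nu> x \<in> topspace Y" using \<nu> x by (auto simp: continuous_map_def Pi_iff)
    ultimately show "sharp act f x \<in> \<Phi> ` topspace Y" by blast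
  qed
  ultimately have sub: "Xf \<subseteq> \<Phi> ` topspace Y" by (intro closure_minimal compact_imp_closed_fun)
  fix \<omega> assume \<omega>: "\<omega> \<in> Xf"
  then obtain y where y: "y \<in> topspace Y" "\<omega> = \<Phi> y" using sub by blast
  show "\<omega> \<in> UC"
    unfolding Xf_UC_iff[OF \<omega>] using SUC_space_eventually[OF SY F y(1)]
    by (simp add: y(2) \<Phi>_def sharp_def)
qed

end

theorem theorem4p12:
  fixes act :: "'g::topological_group_add \<Rightarrow> 'x \<Rightarrow> 'x"
    and X :: "'x topology" and f :: "'x \<Rightarrow> real"
  assumes "G_space act X" and "f \<in> RUC act X"
  shows "(topspace (X_sub act X f) \<subseteq> UC \<longleftrightarrow> SUC_space shift (X_sub act X f)) \<and>
         (SUC_space shift (X_sub act X f) \<longleftrightarrow> f \<in> SUC_funs act X)"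
proof -
  have Xf: "topspace (X_sub act X f) = Xf act X f" unfolding X_sub_eq[OF assms] by simp
  \<comment> \<open>This implication from (3) to (1) closes the cycle begun by (1) to (2) and (2) to
    (3).\<close>
  have "Xf act X f \<subseteq> UC" if S: "f \<in> SUC_funs act X"
  proof -
    obtain actY :: "'g \<Rightarrow> 'x set set \<Rightarrow> 'x set set" and Y \<nu> F
      where "SUC_factorization act X f actY Y \<nu> F"
      using S unfolding SUC_funs_def by (elim CollectE conjE exE)
    then show ?thesis by (rule Xf_UC_if_SUC_factorization[OF assms])
  qed
  then show ?thesis
    unfolding Xf unfolding X_sub_eq[OF assms]
    using SUC_space_Xf_if_UC[OF assms] SUC_funs_if_SUC_space_Xf[OF assms] by iprover
qed

end
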